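(* Let $k$ be a field of characteristic zero and let $$\mathcal{SC}_3=\begin{pmatrix} x_0&x_1&x_2\\ x_2&x_3&x_4\\ x_4&x_5&0\end{pmatrix}$$ over $k[x_0,\ldots,x_5]$. Let $f:=\det\mathcal{SC}_3$ and let $J$ denote the gradient ideal of $f$. Then: (a) $f$ has non-vanishing Hessian determinant. (b) $J$ has maximal linear rank. In particular, $f$ is homaloidal.
   Context: The gradient ideal of $f$ is the ideal generated by all its partial derivatives. For an ideal minimally generated by $n+1$ forms of the same degree in a standard graded polynomial ring, it has maximal linear rank if the submodule of the syzygy module (of these generators) generated by the syzygies whose coordinates are linear forms has rank $n$; here $n=5$. A homogeneous polynomial $f\in k[x_0,\ldots,x_n]$ is homaloidal if its polar map $(\partial f/\partial x_0:\cdots:\partial f/\partial x_n):\mathbb{P}^n\dashrightarrow\mathbb{P}^n$ is birational. *)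

theory Defs
  imports
    "HOL-Analysis.Analysis"
    "HOL-Library.Poly_Mapping"
    "HOL-Library.Numeral_Type"
    "HOL-Computational_Algebra.Fraction_Field"
begin

section \<open>Polynomials over \<open>'k\<close> with variables indexed by \<open>'n\<close>\<close>

text \<open>
  Exponent vectors are finitely supported functions \<open>'n \<Rightarrow>\<^sub>0 nat\<close>; a polynomial maps exponent
  vectors to coefficients, and its ring structure is the convolution product of
  \<^theory>\<open>HOL-Library.Poly_Mapping\<close>.  A linear order on the index type is required only
  because the library's \<^class>\<open>idom\<close> instance asks for one.
\<close>

type_synonym ('n, 'k) mpoly = "('n \<Rightarrow>\<^sub>0 nat) \<Rightarrow>\<^sub>0 'k"

definition Var :: "'n \<Rightarrow> ('n, 'k::comm_ring_1) mpoly" where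
  "Var i = Poly_Mapping.single (Poly_Mapping.single i 1) 1"

definition homogeneous :: "nat \<Rightarrow> ('n::finite, 'k::comm_ring_1) mpoly \<Rightarrow> bool" where
  "homogeneous d p \<longleftrightarrow>
     (\<forall>m\<in>Poly_Mapping.keys p. (\<Sum>i\<in>UNIV. Poly_Mapping.lookup m i) = d)"

text \<open>
  The subtraction of exponents truncates when the variable \<open>i\<close> does not occur in \<open>m\<close>, but then
  the coefficient of that summand is zero.
\<close>

definition partial :: "'n \<Rightarrow> ('n, 'k::comm_ring_1) mpoly \<Rightarrow> ('n, 'k) mpoly" where
  "partial i p =
     (\<Sum>m\<in>Poly_Mapping.keys p.
        Poly_Mapping.single (m - Poly_Mapping.single i 1)
          (of_nat (Poly_Mapping.lookup m i) * Poly_Mapping.lookup p m))"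

text \<open>\<open>subst p F = p(F\<^sub>0, \<dots>, F\<^sub>n)\<close>.\<close>

definition subst ::
  "('n::finite, 'k::comm_ring_1) mpoly \<Rightarrow> ('n, 'k) mpoly ^ 'n \<Rightarrow> ('n, 'k) mpoly" where
  "subst p F =
     (\<Sum>m\<in>Poly_Mapping.keys p.
        Poly_Mapping.single 0 (Poly_Mapping.lookup p m)
          * (\<Prod>i\<in>UNIV. (F $ i) ^ Poly_Mapping.lookup m i))"

definition gradient :: "('n::finite, 'k::comm_ring_1) mpoly \<Rightarrow> ('n, 'k) mpoly ^ 'n" where
  "gradient f = (\<chi> i. partial i f)"

definition Hessian :: "('n::finite, 'k::comm_ring_1) mpoly \<Rightarrow> ('n, 'k) mpoly ^ 'n ^ 'n" where
  "Hessian f = (\<chi> i j. partial i (partial j f))"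


section \<open>Ideals, syzygies and linear rank\<close>

lemma module_mult: "module ((*) :: 'a::comm_ring_1 \<Rightarrow> 'a \<Rightarrow> 'a)"
  by unfold_locales (simp_all add: algebra_simps)

lemma module_vector_smult: "module ((*s) :: 'a::comm_ring_1 \<Rightarrow> 'a ^ 'm \<Rightarrow> 'a ^ 'm)"
  by unfold_locales (simp_all add: vec_eq_iff algebra_simps)

definition ideal_generated :: "'a::comm_ring_1 set \<Rightarrow> 'a set" where
  "ideal_generated S = module.span (*) S"

definition gradient_ideal :: "('n::finite, 'k::comm_ring_1) mpoly \<Rightarrow> ('n, 'k) mpoly set" where
  "gradient_ideal f = ideal_generated (range (\<lambda>i. partial i f))"

definition minimally_generates :: "'a::comm_ring_1 ^ 'm \<Rightarrow> 'a set \<Rightarrow> bool" where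
  "minimally_generates g I \<longleftrightarrow>
     ideal_generated (range (\<lambda>j. g $ j)) = I \<and>
     (\<forall>i. ideal_generated ((\<lambda>j. g $ j) ` (UNIV - {i})) \<noteq> I)"

definition syzygies :: "'a::comm_ring_1 ^ 'm \<Rightarrow> ('a ^ 'm) set" where
  "syzygies g = {s. (\<Sum>j\<in>UNIV. s $ j * g $ j) = 0}"

definition linear_syzygies ::
  "('n::finite, 'k::comm_ring_1) mpoly ^ 'm \<Rightarrow> (('n, 'k) mpoly ^ 'm) set" where
  "linear_syzygies g = {s \<in> syzygies g. \<forall>j. homogeneous 1 (s $ j)}"

text \<open>
  The rank of a submodule \<open>N\<close> of a free module \<open>R\<^sup>m\<close> over a domain \<open>R\<close> is the dimension of
  \<open>N \<otimes> Frac R\<close>, i.e. of the \<open>Frac R\<close>-span of \<open>N\<close> in \<open>(Frac R)\<^sup>m\<close>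
  (the dimension of a set is the dimension of its span).
\<close>

definition submodule_rank :: "('a::idom ^ 'm) set \<Rightarrow> nat" where
  "submodule_rank N = vec.dim ((\<lambda>v. (\<chi> j. Fract (v $ j) 1) :: 'a fract ^ 'm) ` N)"

text \<open>
  The ideal \<open>I\<close>, minimally generated by the \<open>CARD('m)\<close> forms \<open>g\<close> of one common degree, has
  maximal linear rank.  The generators are an argument since the syzygies refer to them, although
  the property does not depend on their choice.
\<close>

definition maximal_linear_rank ::
  "('n::{finite,linorder}, 'k::field) mpoly set \<Rightarrow> ('n, 'k) mpoly ^ 'm \<Rightarrow> bool" where
  "maximal_linear_rank I g \<longleftrightarrow>
     (\<exists>d. \<forall>j. homogeneous d (g $ j)) \<and>
     minimally_generates g I \<and>
     submodule_rank (module.span (*s) (linear_syzygies g)) = CARD('m) - 1"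


section \<open>Rational self-maps of projective space and homaloidal polynomials\<close>

text \<open>
  A rational map \<open>\<P>\<^sup>n \<dashrightarrow> \<P>\<^sup>n\<close> over \<open>k\<close> (where \<open>n + 1 = CARD('n)\<close>) is represented by \<open>n + 1\<close>
  forms of one common degree, not all zero.  Two representatives define the same map iff they are
  proportional over the function field, i.e. iff their 2-by-2 minors vanish.  A composite is
  obtained by substitution and is defined only if the resulting forms are not all zero.
\<close>

definition rational_map :: "('n::finite, 'k::field) mpoly ^ 'n \<Rightarrow> bool" where
  "rational_map F \<longleftrightarrow> F \<noteq> 0 \<and> (\<exists>d. \<forall>i. homogeneous d (F $ i))"

definition same_rational_map ::
  "('n::finite, 'k::field) mpoly ^ 'n \<Rightarrow> ('n, 'k) mpoly ^ 'n \<Rightarrow> bool" where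
  "same_rational_map F G \<longleftrightarrow>
     rational_map F \<and> rational_map G \<and> (\<forall>i j. F $ i * G $ j = F $ j * G $ i)"

definition rational_comp ::
  "('n::finite, 'k::field) mpoly ^ 'n \<Rightarrow> ('n, 'k) mpoly ^ 'n \<Rightarrow> ('n, 'k) mpoly ^ 'n" where
  "rational_comp G F = (\<chi> i. subst (G $ i) F)"

definition rational_id :: "('n::finite, 'k::field) mpoly ^ 'n" where
  "rational_id = (\<chi> i. Var i)"

definition birational :: "('n::finite, 'k::field) mpoly ^ 'n \<Rightarrow> bool" where
  "birational F \<longleftrightarrow> rational_map F \<and>
     (\<exists>G. rational_map G \<and>
        same_rational_map (rational_comp G F) rational_id \<and>
        same_rational_map (rational_comp F G) rational_id)"

definition homaloidal :: "('n::finite, 'k::field) mpoly \<Rightarrow> bool" where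
  "homaloidal f \<longleftrightarrow> (\<exists>d. homogeneous d f) \<and> birational (gradient f)"


section \<open>The matrix\<close>

text \<open>The variables are indexed by the six elements \<open>0, \<dots>, 5\<close> of the numeral type \<open>6\<close>.\<close>

definition SC3 :: "(6, 'k::field) mpoly ^ 3 ^ 3" where
  "SC3 = vector
     [vector [Var 0, Var 1, Var 2],
      vector [Var 2, Var 3, Var 4],
      vector [Var 4, Var 5, 0]]"

end

theory Submission
  imports Defs
begin

text \<open>
  Expanding the determinant gives
  \<open>f = - x\<^sub>0 x\<^sub>4 x\<^sub>5 + x\<^sub>1 x\<^sub>4\<^sup>2 + x\<^sub>2\<^sup>2 x\<^sub>5 - x\<^sub>2 x\<^sub>3 x\<^sub>4\<close>.
  Everything follows from the shape of its six partial derivatives \<open>F\<^sub>0, \<dots>, F\<^sub>5\<close>: once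
  \<open>x\<^sub>4\<close> is known and inverted, each of them except \<open>F\<^sub>1 = x\<^sub>4\<^sup>2\<close> can be solved for one new
  variable.

  The Hessian matrix is therefore triangular up to reordering, that is, only one permutation avoids
  its zero entries.  This permutation is \<open>i \<mapsto> 5 - i\<close>, it is odd, and so the Hessian determinant
  is \<open>- 4 x\<^sub>4\<^sup>6\<close> (\<open>det_unique_transversal\<close>, \<open>Hessian_det_SC3_neq_0\<close>).

  For the linear rank, each \<open>j \<noteq> 1\<close> admits a linear syzygy whose \<open>j\<close>-th coordinate is \<open>x\<^sub>4\<close> and
  which otherwise involves only coordinates treated before.  Over the fraction field these five
  syzygies and the basis vector \<open>e\<^sub>1\<close> span the whole space, while \<open>e\<^sub>1\<close> is not a combination of
  syzygies because \<open>F\<^sub>1 \<noteq> 0\<close>; hence the rank is exactly five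
  (\<open>submodule_rank_syzygies\<close>).  The six partial derivatives generate the gradient ideal
  minimally because each of them contains a quadratic monomial which no other one contains
  (\<open>minimally_generates_private_monomials\<close>).

  Solving \<open>y = F(x)\<close> successively for \<open>x\<^sub>5, x\<^sub>2, x\<^sub>3, x\<^sub>0, x\<^sub>1\<close> with \<open>x\<^sub>4\<^sup>2 = y\<^sub>1\<close>, and clearing
  denominators, yields cubic forms \<open>G\<close> with \<open>G(F(x)) = 2 x\<^sub>4\<^sup>5 x\<close> and
  \<open>F(G(y)) = 4 y\<^sub>1\<^sup>5 y\<close>.  So the polar map is birational.
\<close>

section \<open>Six coordinates\<close>

lemma UNIV_6: "(UNIV :: 6 set) = {0, 1, 2, 3, 4, 5}"
proof -
  have "card {0, 1, 2, 3, 4, 5 :: 6} = 6"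
    by simp
  then show ?thesis
    by (intro card_eq_UNIV_imp_eq_UNIV[symmetric]) auto
qed

lemma forall_6: "(\<forall>i::6. P i) \<longleftrightarrow> P 0 \<and> P 1 \<and> P 2 \<and> P 3 \<and> P 4 \<and> P 5"
proof -
  have "(\<forall>i::6. P i) \<longleftrightarrow> (\<forall>i\<in>UNIV. P i)" by simp
  then show ?thesis unfolding UNIV_6 by simp
qed

lemma sum_6: "sum h (UNIV :: 6 set) = h 0 + h 1 + h 2 + h 3 + h 4 + h 5"
  unfolding UNIV_6 by (simp add: add.assoc)

lemma prod_6: "prod h (UNIV :: 6 set) = h 0 * h 1 * h 2 * h 3 * h 4 * h 5"
  unfolding UNIV_6 by (simp add: mult.assoc)

definition vec6 :: "'a \<Rightarrow> 'a \<Rightarrow> 'a \<Rightarrow> 'a \<Rightarrow> 'a \<Rightarrow> 'a \<Rightarrow> 'a ^ 6" where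
  "vec6 a b c d e g =
     (\<chi> i. if i = 0 then a else if i = 1 then b else if i = 2 then c
          else if i = 3 then d else if i = 4 then e else g)"

lemma vec6_nth [simp]:
  "vec6 a b c d e g $ 0 = a" "vec6 a b c d e g $ 1 = b" "vec6 a b c d e g $ 2 = c"
  "vec6 a b c d e g $ 3 = d" "vec6 a b c d e g $ 4 = e" "vec6 a b c d e g $ 5 = g"
  by (simp_all add: vec6_def)


section \<open>Derivation, substitution and degree\<close>

lemma mpoly_induct [case_names single add]:
  fixes p :: "'a \<Rightarrow>\<^sub>0 'b::monoid_add"
  assumes single: "\<And>m c. P (Poly_Mapping.single m c)"
    and add: "\<And>p q. P p \<Longrightarrow> P q \<Longrightarrow> P (p + q)"
  shows "P p"
proof (induction p rule: update_induct)
  case const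
  show ?case using single[of undefined 0] by simp
next
  case (update f a b)
  have "Poly_Mapping.update a b f = f + Poly_Mapping.single a b"
    using update.hyps
    by (intro poly_mapping_eqI)
      (auto simp: lookup_update lookup_add lookup_single in_keys_iff when_def)
  then show ?case using add single update by simp
qed

text \<open>
  Since the coefficient is part of each summand, the defining sum may range over any finite set of
  exponents containing the support.  A support common to two polynomials then gives additivity.
\<close>

lemma partial_superset:
  assumes "finite S" "Poly_Mapping.keys p \<subseteq> S"
  shows "partial i p = (\<Sum>m\<in>S. Poly_Mapping.single (m - Poly_Mapping.single i 1)
          (of_nat (Poly_Mapping.lookup m i) * Poly_Mapping.lookup p m))"
  unfolding partial_def using assms
  by (intro sum.mono_neutral_left) (auto simp: in_keys_iff)

lemma partial_add [simp]: "partial i (p + q) = partial i p + partial i q"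
proof -
  let ?S = "Poly_Mapping.keys p \<union> Poly_Mapping.keys q"
  have "Poly_Mapping.keys (p + q) \<subseteq> ?S" by (rule keys_add)
  then show ?thesis
    by (simp add: partial_superset[of ?S] lookup_add single_add distrib_left sum.distrib)
qed

lemma partial_single:
  "partial i (Poly_Mapping.single m c) =
     Poly_Mapping.single (m - Poly_Mapping.single i 1) (of_nat (Poly_Mapping.lookup m i) * c)"
  by (subst partial_superset[of "{m}"]) auto

lemma partial_minus [simp]: "partial i (- p) = - partial i p"
proof -
  have "partial i 0 = 0" by (simp add: partial_def)
  then have "partial i (- p) + partial i p = 0"
    by (simp flip: partial_add)
  then show ?thesis by (simp add: eq_neg_iff_add_eq_0)
qed

lemma partial_diff [simp]: "partial i (p - q) = partial i p - partial i q"
  by (simp only: diff_conv_add_uminus partial_add partial_minus)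

lemma partial_numeral [simp]: "partial i (numeral n) = 0"
  using partial_single[of i 0 "numeral n"] by simp

lemma partial_Var: "partial i (Var j) = (if i = j then 1 else 0)"
  unfolding Var_def partial_single by (simp add: lookup_single)

text \<open>
  The delicate point in the Leibniz rule is the truncated subtraction of exponents:
  \<open>(m - e\<^sub>i) + n\<close> and \<open>(m + n) - e\<^sub>i\<close> differ when the variable \<open>i\<close> is absent from \<open>m\<close>, but
  the factor \<open>m\<^sub>i\<close> of the coefficient vanishes in that case.
\<close>

lemma partial_mult_single:
  "partial i (Poly_Mapping.single m a * Poly_Mapping.single n b) =
     partial i (Poly_Mapping.single m a) * Poly_Mapping.single n b +
     Poly_Mapping.single m a * partial i (Poly_Mapping.single n b)"
proof -
  let ?e = "Poly_Mapping.single i (1::nat)"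
  have shift: "m - ?e + n = m + n - ?e" if "Poly_Mapping.lookup m i \<noteq> 0" for m n :: "'a \<Rightarrow>\<^sub>0 nat"
    using that by (intro poly_mapping_eqI) (auto simp: lookup_add lookup_minus lookup_single when_def)
  have "Poly_Mapping.single (m - ?e + n) (of_nat (Poly_Mapping.lookup m i) * a * b)
      = Poly_Mapping.single (m + n - ?e) (of_nat (Poly_Mapping.lookup m i) * a * b)"
    using shift[of m n] by (cases "Poly_Mapping.lookup m i = 0") auto
  moreover have "Poly_Mapping.single (m + (n - ?e)) (a * (of_nat (Poly_Mapping.lookup n i) * b))
      = Poly_Mapping.single (m + n - ?e) (a * (of_nat (Poly_Mapping.lookup n i) * b))"
    using shift[of n m] by (cases "Poly_Mapping.lookup n i = 0") (auto simp: add.commute)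
  ultimately show ?thesis
    by (simp add: partial_single mult_single lookup_add algebra_simps flip: single_add)
qed

lemma partial_mult [simp]: "partial i (p * q) = partial i p * q + p * partial i q"
proof (induction p rule: mpoly_induct)
  case (single m c)
  show ?case
    by (induction q rule: mpoly_induct) (simp_all add: partial_mult_single algebra_simps)
qed (simp add: algebra_simps)

lemma subst_superset:
  assumes "finite S" "Poly_Mapping.keys p \<subseteq> S"
  shows "subst p F = (\<Sum>m\<in>S. Poly_Mapping.single 0 (Poly_Mapping.lookup p m)
          * (\<Prod>i\<in>UNIV. (F $ i) ^ Poly_Mapping.lookup m i))"
  unfolding subst_def using assms
  by (intro sum.mono_neutral_left) (auto simp: in_keys_iff)

lemma subst_add [simp]: "subst (p + q) F = subst p F + subst q F"
proof -
  let ?S = "Poly_Mapping.keys p \<union> Poly_Mapping.keys q"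
  have "Poly_Mapping.keys (p + q) \<subseteq> ?S" by (rule keys_add)
  then show ?thesis
    by (simp add: subst_superset[of ?S] lookup_add single_add distrib_right sum.distrib)
qed

lemma subst_single:
  "subst (Poly_Mapping.single m c) F =
     Poly_Mapping.single 0 c * (\<Prod>i\<in>UNIV. (F $ i) ^ Poly_Mapping.lookup m i)"
  by (subst subst_superset[of "{m}"]) auto

lemma subst_minus [simp]: "subst (- p) F = - subst p F"
proof -
  have "subst 0 F = 0" by (simp add: subst_def)
  then have "subst (- p) F + subst p F = 0"
    by (simp flip: subst_add)
  then show ?thesis by (simp add: eq_neg_iff_add_eq_0)
qed

lemma subst_diff [simp]: "subst (p - q) F = subst p F - subst q F"
  by (simp only: diff_conv_add_uminus subst_add subst_minus)

lemma subst_numeral [simp]: "subst (numeral n) F = numeral n"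
  using subst_single[of 0 "numeral n" F] by simp

lemma subst_Var [simp]: "subst (Var i) F = F $ i"
proof -
  have "(\<Prod>j\<in>UNIV. (F $ j) ^ Poly_Mapping.lookup (Poly_Mapping.single i 1) j)
      = (\<Prod>j\<in>UNIV. if i = j then F $ j else 1)"
    by (intro prod.cong) (auto simp: lookup_single when_def)
  then show ?thesis by (simp add: Var_def subst_single)
qed

lemma subst_mult [simp]: "subst (p * q) F = subst p F * subst q F"
proof (induction p rule: mpoly_induct)
  case (single m a)
  show ?case
  proof (induction q rule: mpoly_induct)
    case (single n b)
    have constants: "Poly_Mapping.single 0 (a * b) = Poly_Mapping.single 0 a * Poly_Mapping.single 0 b"
      by (simp add: mult_single)
    show ?case
      unfolding mult_single[of m a n b] subst_single constants
      by (simp add: lookup_add power_add prod.distrib mult_ac)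
  qed (simp add: algebra_simps)
qed (simp add: algebra_simps)

lemma homogeneous_Var: "homogeneous 1 (Var i)"
  by (simp add: homogeneous_def Var_def lookup_single when_def)

lemma homogeneous_0: "homogeneous d 0"
  by (simp add: homogeneous_def)

lemma homogeneous_numeral: "homogeneous 0 (numeral n)"
proof -
  have "homogeneous 0 (Poly_Mapping.single 0 (numeral n))"
    by (simp add: homogeneous_def del: single_numeral)
  then show ?thesis by simp
qed

lemma homogeneous_add: "homogeneous d p \<Longrightarrow> homogeneous d q \<Longrightarrow> homogeneous d (p + q)"
  using keys_add[of p q] by (auto simp: homogeneous_def)

lemma homogeneous_minus: "homogeneous d p \<Longrightarrow> homogeneous d (- p)"
  by (auto simp: homogeneous_def in_keys_iff)

lemma homogeneous_diff: "homogeneous d p \<Longrightarrow> homogeneous d q \<Longrightarrow> homogeneous d (p - q)"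
  using homogeneous_add[of d p "- q"] homogeneous_minus[of d q] by simp

lemma homogeneous_mult:
  assumes "homogeneous d p" "homogeneous e q" "n = d + e"
  shows "homogeneous n (p * q)"
  unfolding homogeneous_def
proof
  fix m assume "m \<in> Poly_Mapping.keys (p * q)"
  then obtain a b where "a \<in> Poly_Mapping.keys p" "b \<in> Poly_Mapping.keys q" "m = a + b"
    using keys_mult[of p q] by blast
  then show "(\<Sum>i\<in>UNIV. Poly_Mapping.lookup m i) = n"
    using assms by (simp add: homogeneous_def lookup_add sum.distrib)
qed

text \<open>
  The next two rules and those collected after them establish the degree of an expression by
  peeling off one numeral or variable at a time; products must be nested to the right, and degrees
  be written with \<^const>\<open>Suc\<close>.
\<close>

lemma homogeneous_const_mult: "homogeneous d p \<Longrightarrow> homogeneous d (numeral n * p)"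
  by (rule homogeneous_mult[OF homogeneous_numeral]) simp_all

lemma homogeneous_Var_mult: "homogeneous d p \<Longrightarrow> homogeneous (Suc d) (Var i * p)"
  by (rule homogeneous_mult[OF homogeneous_Var]) simp_all

lemmas homogeneous_intros = homogeneous_0 homogeneous_add homogeneous_minus homogeneous_diff
  homogeneous_const_mult homogeneous_Var_mult homogeneous_Var[unfolded One_nat_def]

lemma Var_neq_0 [simp]: "Var i \<noteq> (0 :: ('n, 'k::comm_ring_1) mpoly)"
proof -
  have "Poly_Mapping.keys (Var i :: ('n, 'k) mpoly) \<noteq> {}"
    by (simp add: Var_def)
  then show ?thesis by force
qed


section \<open>The polar map\<close>

lemma det_SC3:
  "det SC3 = - (Var 0 * Var 4 * Var 5) + Var 1 * Var 4 * Var 4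
     + Var 2 * Var 2 * Var 5 - Var 2 * Var 3 * Var 4"
  by (simp add: SC3_def det_3 algebra_simps)

definition polar :: "(6, 'k::field) mpoly ^ 6" where
  "polar = vec6
     (- (Var 4 * Var 5))
     (Var 4 * Var 4)
     (2 * (Var 2 * Var 5) - Var 3 * Var 4)
     (- (Var 2 * Var 4))
     (2 * (Var 1 * Var 4) - Var 0 * Var 5 - Var 2 * Var 3)
     (Var 2 * Var 2 - Var 0 * Var 4)"

lemma gradient_det_SC3: "gradient (det SC3) = polar"
  by (simp add: vec_eq_iff forall_6 gradient_def polar_def det_SC3 partial_Var algebra_simps)

lemma homogeneous_polar: "\<forall>i. homogeneous 2 (polar $ i)"
  unfolding numeral_2_eq_2
  by (simp add: forall_6 polar_def homogeneous_intros)


section \<open>The Hessian determinant\<close>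

text \<open>
  A matrix that is triangular after independent permutations of its rows and columns, with non-zero
  diagonal, has only one non-vanishing term in the Leibniz expansion.  In this form no reordering
  of the index type has to be carried out.
\<close>

lemma det_unique_transversal:
  fixes A :: "'a::comm_ring_1 ^ 'n ^ 'n"
  assumes "p permutes UNIV"
    and "\<And>q. q permutes UNIV \<Longrightarrow> (\<And>i. A $ i $ q i \<noteq> 0) \<Longrightarrow> q = p"
  shows "det A = of_int (sign p) * (\<Prod>i\<in>UNIV. A $ i $ p i)"
proof -
  have "(\<Prod>i\<in>UNIV. A $ i $ q i) = 0" if "q permutes UNIV" "q \<noteq> p" for q
  proof -
    obtain i where "A $ i $ q i = 0"
      using assms(2) \<open>q permutes UNIV\<close> \<open>q \<noteq> p\<close> by metis
    then show ?thesis by (auto intro!: prod_zero)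
  qed
  then have "det A = (\<Sum>q\<in>{p}. of_int (sign q) * (\<Prod>i\<in>UNIV. A $ i $ q i))"
    unfolding det_def using assms(1) by (intro sum.mono_neutral_right) (auto simp: finite_permutations)
  then show ?thesis by simp
qed

lemma Hessian_det_SC3:
  "Hessian (det SC3) $ i $ j = partial i (polar $ j)"
  by (simp add: Hessian_def gradient_def flip: gradient_det_SC3)

lemma Hessian_det_SC3_neq_0:
  "det (Hessian (det SC3 :: (6, 'k::field_char_0) mpoly)) \<noteq> 0"
proof -
  let ?H = "Hessian (det SC3 :: (6, 'k) mpoly)"
  let ?p = "\<lambda>i::6. 5 - i"
  have perm: "?p permutes UNIV"
    by (rule bij_imp_permutes) (auto intro: involuntory_imp_bij)
  have "q = ?p" if q: "q permutes UNIV" and nz: "\<And>i. ?H $ i $ q i \<noteq> 0" for q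
  proof -
    have inj: "q i = q j \<Longrightarrow> i = j" for i j
      using permutes_inj[OF q] by (auto dest: injD)
    have range: "q i = 0 \<or> q i = 1 \<or> q i = 2 \<or> q i = 3 \<or> q i = 4 \<or> q i = 5" for i
      using UNIV_6 by blast
    \<comment> \<open>The rows are taken in the order \<open>1, 0, 3, 5, 2, 4\<close>: apart from the columns that are
      already occupied, each has a single non-zero entry left.\<close>
    have q1: "q 1 = 4"
      using range[of 1] nz[of 1] by (auto simp: Hessian_det_SC3 polar_def partial_Var)
    have q0: "q 0 = 5"
      using range[of 0] nz[of 0] inj[of 0 1] q1 by (auto simp: Hessian_det_SC3 polar_def partial_Var)
    have q3: "q 3 = 2"
      using range[of 3] nz[of 3] inj[of 3 1] q1 by (auto simp: Hessian_det_SC3 polar_def partial_Var)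
    have q5: "q 5 = 0"
      using range[of 5] nz[of 5] inj[of 5 1] inj[of 5 3] q1 q3
      by (auto simp: Hessian_det_SC3 polar_def partial_Var)
    have q2: "q 2 = 3"
      using range[of 2] nz[of 2] inj[of 2 0] inj[of 2 1] inj[of 2 3] q0 q1 q3
      by (auto simp: Hessian_det_SC3 polar_def partial_Var)
    have q4: "q 4 = 1"
      using range[of 4] inj[of 4 0] inj[of 4 1] inj[of 4 2] inj[of 4 3] inj[of 4 5] q0 q1 q2 q3 q5
      by auto
    have "\<forall>i. q i = ?p i"
      unfolding forall_6 using q0 q1 q2 q3 q4 q5 by simp
    then show ?thesis by blast
  qed
  then have "det ?H = of_int (sign ?p) * (\<Prod>i\<in>UNIV. ?H $ i $ ?p i)"
    by (rule det_unique_transversal[OF perm])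
  moreover have "of_int (sign ?p) \<noteq> (0 :: (6, 'k) mpoly)"
    by (simp add: sign_def)
  moreover have "(\<Prod>i\<in>UNIV. ?H $ i $ ?p i) \<noteq> 0"
    by (simp add: prod_6 Hessian_det_SC3 polar_def partial_Var)
  ultimately show ?thesis by simp
qed


section \<open>Minimal generation\<close>

text \<open>
  The largest monomial ideal that does not contain the monomial with exponent \<open>m\<close>.
\<close>

definition without_divisors :: "('n \<Rightarrow>\<^sub>0 nat) \<Rightarrow> ('n, 'k::comm_ring_1) mpoly set" where
  "without_divisors m = {p. \<forall>l\<in>Poly_Mapping.keys p. \<forall>k. m \<noteq> k + l}"

lemma without_divisors_add:
  "p \<in> without_divisors m \<Longrightarrow> q \<in> without_divisors m \<Longrightarrow> p + q \<in> without_divisors m"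
  using keys_add[of p q] by (auto simp: without_divisors_def)

lemma without_divisors_mult:
  assumes "p \<in> without_divisors m"
  shows "a * p \<in> without_divisors m"
proof -
  have "m \<noteq> k + l" if "l \<in> Poly_Mapping.keys (a * p)" for l k
  proof -
    obtain u v where "v \<in> Poly_Mapping.keys p" "l = u + v"
      using keys_mult[of a p] \<open>l \<in> Poly_Mapping.keys (a * p)\<close> by blast
    then show ?thesis
      using assms by (simp add: without_divisors_def flip: add.assoc)
  qed
  then show ?thesis by (simp add: without_divisors_def)
qed

text \<open>
  Together with the two lemmas that follow, this reduces membership of an expression to membership
  of its terms, provided that at most one of the terms lies outside the ideal.
\<close>

lemma without_divisors_minus_iff:
  "- p \<in> without_divisors m \<longleftrightarrow> p \<in> without_divisors m"
  using without_divisors_mult[of p m "- 1"] without_divisors_mult[of "- p" m "- 1"] by auto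

lemma without_divisors_add_iff:
  "p \<in> without_divisors m \<Longrightarrow> p + q \<in> without_divisors m \<longleftrightarrow> q \<in> without_divisors m"
  "q \<in> without_divisors m \<Longrightarrow> p + q \<in> without_divisors m \<longleftrightarrow> p \<in> without_divisors m"
  using without_divisors_add[of p m q] without_divisors_add[of "p + q" m "- p"]
    without_divisors_add[of "p + q" m "- q"]
  by (auto simp: without_divisors_minus_iff)

lemma without_divisors_diff_iff:
  "p \<in> without_divisors m \<Longrightarrow> p - q \<in> without_divisors m \<longleftrightarrow> q \<in> without_divisors m"
  "q \<in> without_divisors m \<Longrightarrow> p - q \<in> without_divisors m \<longleftrightarrow> p \<in> without_divisors m"
  using without_divisors_add_iff[of p m "- q"] without_divisors_add_iff[of "- q" m p]
  by (simp_all add: without_divisors_minus_iff add.commute)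

lemma ideal_generated_subset_without_divisors:
  assumes "S \<subseteq> without_divisors m"
  shows "ideal_generated S \<subseteq> without_divisors m"
  unfolding ideal_generated_def
proof (rule module.span_minimal[OF module_mult assms])
  show "module.subspace (*) (without_divisors m)"
    by (rule module.subspaceI[OF module_mult])
      (simp_all add: without_divisors_add without_divisors_mult, simp add: without_divisors_def)
qed

text \<open>
  If \<open>m\<close> is a monomial witnessing that \<open>g\<^sub>i\<close> lies outside a monomial ideal to which all other
  generators belong, then the ideal generated by those others cannot contain \<open>g\<^sub>i\<close>.
\<close>

lemma minimally_generates_private_monomials:
  assumes "\<And>i. \<exists>m. g $ i \<notin> without_divisors m \<and> (\<forall>j. j \<noteq> i \<longrightarrow> g $ j \<in> without_divisors m)"
  shows "minimally_generates g (ideal_generated (range (\<lambda>j. g $ j)))"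
  unfolding minimally_generates_def
proof (intro conjI allI refl notI)
  fix i
  assume eq: "ideal_generated ((\<lambda>j. g $ j) ` (UNIV - {i})) = ideal_generated (range (\<lambda>j. g $ j))"
  obtain m where m: "g $ i \<notin> without_divisors m" "\<And>j. j \<noteq> i \<Longrightarrow> g $ j \<in> without_divisors m"
    using assms by blast
  have "g $ i \<in> ideal_generated (range (\<lambda>j. g $ j))"
    unfolding ideal_generated_def by (rule module.span_base[OF module_mult]) simp
  also have "\<dots> = ideal_generated ((\<lambda>j. g $ j) ` (UNIV - {i}))"
    by (simp add: eq)
  also have "\<dots> \<subseteq> without_divisors m"
    using m(2) by (intro ideal_generated_subset_without_divisors) auto
  finally show False using m(1) by simp
qed

definition quadratic :: "'n \<Rightarrow> 'n \<Rightarrow> 'n \<Rightarrow>\<^sub>0 nat" where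
  "quadratic a b = Poly_Mapping.single a 1 + Poly_Mapping.single b 1"

lemma Var_mult_Var: "Var a * Var b = Poly_Mapping.single (quadratic a b) 1"
  by (simp add: Var_def quadratic_def mult_single)

text \<open>
  Two monomials of the same degree divide each other only if they are equal.  The exponents of the
  two variables \<open>a\<close> and \<open>b\<close> alone decide this.
\<close>

lemma Var_mult_Var_in_without_divisors:
  "Var a * Var b \<in> (without_divisors (quadratic c d) :: ('n, 'k::comm_ring_1) mpoly set) \<longleftrightarrow>
     \<not> (a = c \<and> b = d \<or> a = d \<and> b = c)"
proof -
  have "quadratic c d \<noteq> k + quadratic a b" if "\<not> (a = c \<and> b = d \<or> a = d \<and> b = c)" for k
  proof
    assume "quadratic c d = k + quadratic a b"
    then have "Poly_Mapping.lookup (quadratic c d) i = Poly_Mapping.lookup (k + quadratic a b) i" for i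
      by simp
    from this[of a] this[of b] show False
      using that by (auto simp: quadratic_def lookup_add lookup_single when_def split: if_splits)
  qed
  moreover have "quadratic c d = 0 + quadratic a b" if "a = c \<and> b = d \<or> a = d \<and> b = c"
    using that by (auto simp: quadratic_def add.commute)
  ultimately show ?thesis
    by (auto simp: without_divisors_def Var_mult_Var)
qed

lemma minimally_generates_polar:
  "minimally_generates polar (ideal_generated (range (\<lambda>j. (polar :: (6, 'k::field) mpoly ^ 6) $ j)))"
proof (rule minimally_generates_private_monomials)
  let ?F = "polar :: (6, 'k) mpoly ^ 6"
  \<comment> \<open>A monomial with coefficient \<open>1\<close> or \<open>-1\<close> of each partial derivative that the other five
    do not contain.\<close>
  let ?m = "vec6 (quadratic 4 5) (quadratic 4 4) (quadratic 3 4) (quadratic 2 4) (quadratic 0 5)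
    (quadratic 0 4) :: (6 \<Rightarrow>\<^sub>0 nat) ^ 6"
  have "\<forall>i. ?F $ i \<notin> without_divisors (?m $ i) \<and>
    (\<forall>j. j \<noteq> i \<longrightarrow> ?F $ j \<in> without_divisors (?m $ i))"
    by (simp add: forall_6 polar_def without_divisors_add_iff without_divisors_diff_iff
        without_divisors_minus_iff without_divisors_mult Var_mult_Var_in_without_divisors)
  then show "\<exists>m. ?F $ i \<notin> without_divisors m \<and>
      (\<forall>j. j \<noteq> i \<longrightarrow> ?F $ j \<in> without_divisors m)" for i
    by blast
qed


section \<open>Linear rank\<close>

text \<open>
  One step of Gaussian elimination: a vector of \<open>W\<close> whose other non-zero positions are already
  covered by basis vectors in \<open>W\<close> contributes the basis vector of its pivot.
\<close>

lemma axis_in_subspace_pivot: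
  fixes W :: "('a::field ^ 'm) set"
  assumes W: "vec.subspace W" and "v \<in> W" and "v $ j \<noteq> 0"
    and others: "\<forall>i. i \<noteq> j \<longrightarrow> v $ i \<noteq> 0 \<longrightarrow> axis i 1 \<in> W"
  shows "axis j 1 \<in> W"
proof -
  let ?rest = "\<Sum>i\<in>UNIV - {j}. v $ i *s axis i 1"
  have "v = (\<Sum>i\<in>UNIV. v $ i *s axis i 1)"
    by (simp add: vec_eq_iff axis_def if_distrib cong: if_cong)
  also have "\<dots> = v $ j *s axis j 1 + ?rest"
    by (simp add: sum.remove)
  finally have "v - ?rest = v $ j *s axis j 1"
    by (simp add: algebra_simps)
  moreover have "axis j 1 = inverse (v $ j) *s (v $ j *s axis j 1)"
    using \<open>v $ j \<noteq> 0\<close> by (simp add: vec_eq_iff)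
  ultimately have "axis j 1 = inverse (v $ j) *s (v - ?rest)"
    by simp
  moreover have "?rest \<in> W"
  proof (rule vec.subspace_sum[OF W])
    fix i assume "i \<in> UNIV - {j}"
    then show "v $ i *s axis i 1 \<in> W"
      using others vec.subspace_0[OF W]
      by (cases "v $ i = 0") (auto intro: vec.subspace_scale[OF W])
  qed
  ultimately show ?thesis
    using assms(2) by (simp add: vec.subspace_scale[OF W] vec.subspace_diff[OF W])
qed

abbreviation to_fract :: "'a::idom ^ 'm \<Rightarrow> 'a fract ^ 'm" where
  "to_fract v \<equiv> (\<chi> j. Fract (v $ j) 1)"

lemma Fract_eq_0_iff: "Fract a 1 = 0 \<longleftrightarrow> a = 0"
  by (simp add: Zero_fract_def eq_fract)

lemma Fract_add: "Fract (a + b) 1 = Fract a 1 + Fract b 1"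
  by (simp add: add_fract)

text \<open>
  Syzygies lie in the hyperplane orthogonal to \<open>g\<close>, which misses \<open>e\<^sub>p\<close> when \<open>g\<^sub>p \<noteq> 0\<close>.  So
  adjoining \<open>e\<^sub>p\<close> raises the dimension by exactly one, and if the result is everything, the rank
  is one less than the number of generators.  This gives both bounds at once, without a separate
  proof of linear independence.
\<close>

lemma submodule_rank_syzygies:
  fixes g :: "'a::idom ^ 'm"
  assumes N: "N \<subseteq> syzygies g" and p: "g $ p \<noteq> 0"
    and full: "vec.span (insert (axis p 1) (to_fract ` N)) = UNIV"
  shows "submodule_rank N = CARD('m) - 1"
proof -
  let ?S = "{v :: 'a fract ^ 'm. (\<Sum>j\<in>UNIV. v $ j * Fract (g $ j) 1) = 0}"
  have Fract_sum: "Fract (sum h A) 1 = (\<Sum>x\<in>A. Fract (h x) 1)" if "finite A" for h :: "'m \<Rightarrow> 'a" and A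
    using that by (induction A) (simp_all add: Fract_eq_0_iff Fract_add)
  have "vec.subspace ?S"
    by (rule vec.subspaceI) (simp_all add: distrib_right sum.distrib mult.assoc flip: sum_distrib_left)
  moreover have "to_fract ` N \<subseteq> ?S"
  proof
    fix w assume "w \<in> to_fract ` N"
    then obtain s where s: "s \<in> N" "w = to_fract s" by blast
    have "(\<Sum>j\<in>UNIV. w $ j * Fract (g $ j) 1) = Fract (\<Sum>j\<in>UNIV. s $ j * g $ j) 1"
      using s(2) by (simp add: Fract_sum)
    also have "\<dots> = 0"
      using s(1) N by (auto simp: syzygies_def Zero_fract_def)
    finally show "w \<in> ?S" by simp
  qed
  ultimately have "vec.span (to_fract ` N) \<subseteq> ?S"
    by (intro vec.span_minimal)
  moreover have "axis p 1 \<notin> ?S"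
    using p by (simp add: axis_def if_distribR if_distrib Fract_eq_0_iff cong: if_cong)
  ultimately have "axis p 1 \<notin> vec.span (to_fract ` N)" by blast
  then have "vec.dim (insert (axis p 1) (to_fract ` N)) = vec.dim (to_fract ` N) + 1"
    by (simp add: vec.dim_insert)
  moreover have "vec.dim (insert (axis p 1) (to_fract ` N)) = CARD('m)"
    using full by (metis vec.dim_span vec_dim_card)
  ultimately show ?thesis
    by (simp add: submodule_rank_def)
qed

lemma submodule_rank_linear_syzygies_polar:
  "submodule_rank (module.span (*s) (linear_syzygies (polar :: (6, 'k::field) mpoly ^ 6))) = 5"
proof -
  let ?g = "polar :: (6, 'k) mpoly ^ 6"
  let ?N = "module.span (*s) (linear_syzygies ?g)"
  let ?W = "vec.span (insert (axis 1 1) (to_fract ` ?N))"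
  have "module.subspace (*s) (syzygies ?g)"
    by (rule module.subspaceI[OF module_vector_smult])
      (simp_all add: syzygies_def distrib_right sum.distrib mult.assoc flip: sum_distrib_left)
  then have N: "?N \<subseteq> syzygies ?g"
    by (intro module.span_minimal[OF module_vector_smult]) (auto simp: linear_syzygies_def)
  have W: "vec.subspace ?W" by (rule vec.subspace_span)
  have e1: "axis 1 1 \<in> ?W" by (rule vec.span_base) simp
  have in_W: "to_fract s \<in> ?W" if "s \<in> linear_syzygies ?g" for s
    using that by (intro vec.span_base insertI2 imageI module.span_base[OF module_vector_smult])
  note linear = linear_syzygies_def syzygies_def forall_6 sum_6 homogeneous_intros
  note pivot = axis_in_subspace_pivot[OF W in_W]
  \<comment> \<open>The syzygy numbered \<open>j\<close> has pivot \<open>x\<^sub>4\<close> in position \<open>j\<close>.  It expresses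
    \<open>x\<^sub>4 F\<^sub>j\<close> as a combination of partial derivatives handled earlier in the order
    \<open>1, 0, 3, 5, 2, 4\<close>.\<close>
  let ?s0 = "vec6 (Var 4) (Var 5) 0 0 0 0 :: (6, 'k) mpoly ^ 6"
  let ?s3 = "vec6 0 (Var 2) 0 (Var 4) 0 0 :: (6, 'k) mpoly ^ 6"
  let ?s5 = "vec6 0 (Var 0) 0 (Var 2) 0 (Var 4) :: (6, 'k) mpoly ^ 6"
  let ?s2 = "vec6 (2 * Var 2) (Var 3) (Var 4) 0 0 0 :: (6, 'k) mpoly ^ 6"
  let ?s4 = "vec6 (- Var 0) (- (2 * Var 1)) 0 (- Var 3) (Var 4) 0 :: (6, 'k) mpoly ^ 6"
  have "?s0 \<in> linear_syzygies ?g" "?s3 \<in> linear_syzygies ?g" "?s5 \<in> linear_syzygies ?g"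
    "?s2 \<in> linear_syzygies ?g" "?s4 \<in> linear_syzygies ?g"
    by (simp_all add: linear polar_def, simp_all add: algebra_simps)
  note s = this
  have e0: "axis 0 1 \<in> ?W"
    by (rule pivot[OF s(1)]) (simp_all add: forall_6 Fract_eq_0_iff e1)
  have e3: "axis 3 1 \<in> ?W"
    by (rule pivot[OF s(2)]) (simp_all add: forall_6 Fract_eq_0_iff e1)
  have e5: "axis 5 1 \<in> ?W"
    by (rule pivot[OF s(3)]) (simp_all add: forall_6 Fract_eq_0_iff e1 e3)
  have e2: "axis 2 1 \<in> ?W"
    by (rule pivot[OF s(4)]) (simp_all add: forall_6 Fract_eq_0_iff e0 e1)
  have e4: "axis 4 1 \<in> ?W"
    by (rule pivot[OF s(5)]) (simp_all add: forall_6 Fract_eq_0_iff e0 e1 e3)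
  have "\<forall>i. axis i 1 \<in> ?W"
    unfolding forall_6 using e0 e1 e2 e3 e4 e5 by blast
  then have "cart_basis \<subseteq> ?W"
    by (auto simp: cart_basis_def)
  then have "?W = UNIV"
    using vec.span_minimal[OF _ W] span_cart_basis by blast
  moreover have "?g $ 1 \<noteq> 0"
    by (simp add: polar_def)
  ultimately show ?thesis
    using submodule_rank_syzygies[OF N] by simp
qed


section \<open>The inverse of the polar map\<close>

text \<open>
  Put \<open>t = x\<^sub>4\<close> and \<open>y = F(x)\<close>, so that \<open>t\<^sup>2 = y\<^sub>1\<close>.  Then
  \<open>t x\<^sub>5 = - y\<^sub>0\<close>, \<open>t x\<^sub>2 = - y\<^sub>3\<close>, \<open>t x\<^sub>3 = 2 x\<^sub>2 x\<^sub>5 - y\<^sub>2\<close>,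
  \<open>t x\<^sub>0 = x\<^sub>2\<^sup>2 - y\<^sub>5\<close> and \<open>2 t x\<^sub>1 = y\<^sub>4 + x\<^sub>0 x\<^sub>5 + x\<^sub>2 x\<^sub>3\<close>.
  Every product \<open>x\<^sub>a x\<^sub>b\<close> on the right equals \<open>(t x\<^sub>a) (t x\<^sub>b) / y\<^sub>1\<close>, so each \<open>t x\<^sub>i\<close> is
  a rational function of \<open>y\<close>; the components below are \<open>2 y\<^sub>1\<^sup>2 t x\<^sub>i\<close>, which clears all
  denominators.
\<close>

definition polar_inverse :: "(6, 'k::field) mpoly ^ 6" where
  "polar_inverse = vec6
     (2 * (Var 1 * (Var 3 * Var 3)) - 2 * (Var 1 * (Var 1 * Var 5)))
     (Var 1 * (Var 1 * Var 4) - 3 * (Var 0 * (Var 3 * Var 3)) + Var 0 * (Var 1 * Var 5)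
        + Var 1 * (Var 2 * Var 3))
     (- (2 * (Var 1 * (Var 1 * Var 3))))
     (4 * (Var 0 * (Var 1 * Var 3)) - 2 * (Var 1 * (Var 1 * Var 2)))
     (2 * (Var 1 * (Var 1 * Var 1)))
     (- (2 * (Var 0 * (Var 1 * Var 1))))"

lemma homogeneous_polar_inverse: "\<forall>i. homogeneous 3 (polar_inverse $ i)"
  unfolding numeral_3_eq_3
  by (simp add: forall_6 polar_inverse_def homogeneous_intros)

lemma polar_inverse_comp_polar:
  "rational_comp polar_inverse polar $ i = 2 * Var 4 ^ 5 * Var i"
proof -
  have "\<forall>i. rational_comp polar_inverse polar $ i = (2 * Var 4 ^ 5 * Var i :: (6, 'k::field) mpoly)"
    unfolding forall_6
    by (simp add: rational_comp_def polar_inverse_def, simp add: polar_def,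
        simp add: algebra_simps eval_nat_numeral)
  then show ?thesis by blast
qed

lemma polar_comp_polar_inverse:
  "rational_comp polar polar_inverse $ i = 4 * Var 1 ^ 5 * Var i"
proof -
  have "\<forall>i. rational_comp polar polar_inverse $ i = (4 * Var 1 ^ 5 * Var i :: (6, 'k::field) mpoly)"
    unfolding forall_6
    by (simp add: rational_comp_def polar_def, simp add: polar_inverse_def,
        simp add: algebra_simps eval_nat_numeral)
  then show ?thesis by blast
qed

lemma rational_map_id: "rational_map (rational_id :: ('n::finite, 'k::field) mpoly ^ 'n)"
  using homogeneous_Var by (auto simp: rational_map_def rational_id_def vec_eq_iff)

lemma same_rational_map_id:
  fixes c :: "('n::{finite,linorder}, 'k::field) mpoly"
  assumes "homogeneous d c" "c \<noteq> 0" "\<And>i. F $ i = c * Var i"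
  shows "same_rational_map F rational_id"
proof -
  have "\<forall>i. homogeneous (d + 1) (F $ i)"
    using homogeneous_mult[OF assms(1) homogeneous_Var refl] by (simp add: assms(3))
  moreover have "F \<noteq> 0"
    using assms by (auto simp: vec_eq_iff)
  ultimately show ?thesis
    using assms(3) rational_map_id by (auto simp: same_rational_map_def rational_map_def rational_id_def)
qed

lemma homogeneous_Var_power: "homogeneous n (Var i ^ n)"
  by (induction n) (auto simp: homogeneous_Var_mult, simp add: homogeneous_def)

lemma birational_polar: "birational (polar :: (6, 'k::field_char_0) mpoly ^ 6)"
proof -
  have "(polar :: (6, 'k) mpoly ^ 6) $ 1 \<noteq> 0" "(polar_inverse :: (6, 'k) mpoly ^ 6) $ 4 \<noteq> 0"
    by (simp_all add: polar_def polar_inverse_def)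
  then have "rational_map (polar :: (6, 'k) mpoly ^ 6)" "rational_map (polar_inverse :: (6, 'k) mpoly ^ 6)"
    using homogeneous_polar homogeneous_polar_inverse by (force simp: rational_map_def)+
  moreover have "same_rational_map (rational_comp polar_inverse polar) (rational_id :: (6, 'k) mpoly ^ 6)"
    by (rule same_rational_map_id[OF _ _ polar_inverse_comp_polar])
      (auto intro: homogeneous_const_mult homogeneous_Var_power)
  moreover have "same_rational_map (rational_comp polar polar_inverse) (rational_id :: (6, 'k) mpoly ^ 6)"
    by (rule same_rational_map_id[OF _ _ polar_comp_polar_inverse])
      (auto intro: homogeneous_const_mult homogeneous_Var_power)
  ultimately show ?thesis
    unfolding birational_def by blast
qed

section \<open>Hessian, linear rank and homaloidality\<close>

theorem proposition4p10:
  fixes f :: "(6, 'k::field_char_0) mpoly" and J :: "(6, 'k) mpoly set"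
  assumes f: "f = det SC3" and J: "J = gradient_ideal f"
  shows "det (Hessian f) \<noteq> 0 \<and> maximal_linear_rank J (gradient f) \<and> homaloidal f"
proof (intro conjI)
  have grad: "gradient f = polar"
    unfolding f by (rule gradient_det_SC3)
  then have "partial i f = polar $ i" for i
    by (metis gradient_def vec_lambda_beta)
  then have J_polar: "J = ideal_generated (range (\<lambda>j. polar $ j))"
    by (simp add: J gradient_ideal_def)
  show "det (Hessian f) \<noteq> 0"
    unfolding f by (rule Hessian_det_SC3_neq_0)
  show "maximal_linear_rank J (gradient f)"
    using homogeneous_polar minimally_generates_polar submodule_rank_linear_syzygies_polar
    by (auto simp: maximal_linear_rank_def grad J_polar)
  have "homogeneous 3 f"
    unfolding f det_SC3 numeral_3_eq_3 by (simp add: homogeneous_intros mult.assoc)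
  then show "homaloidal f"
    using birational_polar by (auto simp: homaloidal_def grad)
qed

end
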